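(* Let $G$ be a (not necessarily connected) graph of order $n\ge 2$ and let $\overline G$ be its complement. Then $3\le\lambda(G)+\lambda(\overline G)\le 2n-1$. Moreover: (i) $\lambda(G)+\lambda(\overline G)=3$ if and only if $\{G,\overline G\}=\{K_2,\overline K_2\}$; (ii) $\lambda(G)+\lambda(\overline G)=2n-1$ if and only if $\{G,\overline G\}=\{K_n,\overline K_n\}$. (Equalities of graphs are up to isomorphism.)
   Context: Graphs are finite, simple and undirected, and not necessarily connected; a graph is nontrivial if it has order $n\ge 2$. $K_n$ is the complete graph and $\overline K_n$ the edgeless graph on $n$ vertices. For a graph $G=(V,E)$, $N(v)$ is the open neighborhood of $v$. A set $D\subseteq V$ is a locating-dominating set (LD-set) if $N(u)\cap D\neq\emptyset$ for every $u\in V\setminus D$ and $N(u)\cap D\ne N(v)\cap D$ for every two distinct vertices $u,v\in V\setminus D$. The location-domination number $\lambda(G)$ is the minimum cardinality of a locating-dominating set of $G$. *)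

theory Defs
  imports "Graph_Theory.Graph_Theory"
begin

text \<open>
  A finite simple undirected graph is a \<open>pair_graph\<close>: finite, loop-free, with a symmetric set of
  arcs, so that an undirected edge between \<open>u\<close> and \<open>v\<close> is the pair of arcs \<open>(u, v)\<close>, \<open>(v, u)\<close>.
\<close>

definition neighborhood :: "'a pair_pre_digraph \<Rightarrow> 'a \<Rightarrow> 'a set" where
  "neighborhood G v = {u \<in> pverts G. (v, u) \<in> parcs G}"

definition graph_complement :: "'a pair_pre_digraph \<Rightarrow> 'a pair_pre_digraph" where
  "graph_complement G =
     \<lparr> pverts = pverts G,
       parcs = {(u, v). u \<in> pverts G \<and> v \<in> pverts G \<and> u \<noteq> v \<and> (u, v) \<notin> parcs G} \<rparr>"

definition complete_graph :: "nat \<Rightarrow> nat pair_pre_digraph" where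
  "complete_graph n = \<lparr> pverts = {..<n}, parcs = {(u, v). u < n \<and> v < n \<and> u \<noteq> v} \<rparr>"

definition locating_dominating :: "'a pair_pre_digraph \<Rightarrow> 'a set \<Rightarrow> bool" where
  "locating_dominating G D \<longleftrightarrow>
     D \<subseteq> pverts G \<and>
     (\<forall>u \<in> pverts G - D. neighborhood G u \<inter> D \<noteq> {}) \<and>
     (\<forall>u \<in> pverts G - D. \<forall>v \<in> pverts G - D.
        u \<noteq> v \<longrightarrow> neighborhood G u \<inter> D \<noteq> neighborhood G v \<inter> D)"

text \<open>The whole vertex set is locating-dominating, so the minimum below is attained.\<close>

definition location_domination_number :: "'a pair_pre_digraph \<Rightarrow> nat" where
  "location_domination_number G = (LEAST k. \<exists>D. locating_dominating G D \<and> card D = k)"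

abbreviation graph_iso :: "'a pair_pre_digraph \<Rightarrow> 'b pair_pre_digraph \<Rightarrow> bool" where
  "graph_iso G H \<equiv> digraph_iso (with_proj G) (with_proj H)"

text \<open>
  Equality of unordered pairs of graphs up to isomorphism. Since \<open>{G, G'} = {H, H'}\<close> unfolds to
  \<open>G = H \<and> G' = H' \<or> G = H' \<and> G' = H\<close>, each equality is replaced by an isomorphism.
\<close>

definition same_graph_pair ::
  "'a pair_pre_digraph \<Rightarrow> 'a pair_pre_digraph \<Rightarrow> 'b pair_pre_digraph \<Rightarrow> 'b pair_pre_digraph \<Rightarrow> bool"
where
  "same_graph_pair G G' H H' \<longleftrightarrow>
     graph_iso G H \<and> graph_iso G' H' \<or> graph_iso G H' \<and> graph_iso G' H"

lemma locating_dominating_pverts: "locating_dominating G (pverts G)"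
  by (simp add: locating_dominating_def)

lemma pair_graph_graph_complement:
  assumes "pair_graph G"
  shows "pair_graph (graph_complement G)"
proof -
  interpret pair_graph G by fact
  have "finite (pverts G \<times> pverts G)"
    using pair_finite_verts by simp
  then have "finite (parcs (graph_complement G))"
    by (rule rev_finite_subset) (auto simp: graph_complement_def)
  then show ?thesis
    using pair_finite_verts pair_sym_arcs
    by unfold_locales (auto simp: graph_complement_def symmetric_def intro!: symI dest: symD)
qed

lemma complete_digraph_complete_graph: "complete_digraph n (with_proj (complete_graph n))"
  unfolding complete_digraph_pair_def by (auto simp: complete_graph_def)

lemma graph_complement_complete_graph:
  "graph_complement (complete_graph n) = \<lparr> pverts = {..<n}, parcs = {} \<rparr>"
  by (auto simp: graph_complement_def complete_graph_def)

end

theory Submission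
  imports Defs
begin

text \<open>
  Deleting an endpoint of an edge from the vertex set leaves a locating-dominating set, so
  \<open>\<lambda>(G) \<le> n - 1\<close> unless \<open>G\<close> is edgeless; applied to both \<open>G\<close> and its complement this gives
  \<open>\<lambda>(G) + \<lambda>(complement of G) \<le> 2n - 2\<close> unless one of the two is edgeless, that is, unless they are
  \<open>K\<^sub>n\<close> and its complement, whose numbers are \<open>n - 1\<close> and \<open>n\<close>. For the lower bound, a
  locating-dominating set of size 1 can locate at most one vertex outside it, so both numbers are at
  least 2 as soon as \<open>n \<ge> 3\<close>. A graph on two vertices is complete or edgeless.
\<close>

section \<open>Isomorphism with complete and edgeless graphs\<close>

lemma graph_iso_iff:
  assumes "pair_wf_digraph G"
  shows "graph_iso G H \<longleftrightarrow>
    (\<exists>f. bij_betw f (pverts G) (pverts H) \<and> parcs H = map_prod f f ` parcs G)"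
proof
  interpret pair_wf_digraph G by fact
  assume "graph_iso G H"
  then obtain h where h: "digraph_isomorphism h" and H: "with_proj H = app_iso h (with_proj G)"
    unfolding digraph_iso_def by blast
  have eqs: "pverts H = iso_verts h ` pverts G" "parcs H = iso_arcs h ` parcs G"
    "iso_tail h = fst" "iso_head h = snd"
    using H by (auto simp: with_proj_def app_iso_def)
  \<comment> \<open>Tail and head in the image are again \<open>fst\<close> and \<open>snd\<close>,
    so an arc has to go to the pair of images of its ends.\<close>
  have "iso_arcs h a = map_prod (iso_verts h) (iso_verts h) a" if "a \<in> parcs G" for a
    using iso_verts_tail[OF h, of a] iso_verts_head[OF h, of a] that eqs
    by (cases a) (auto simp: prod_eq_iff)
  then have "parcs H = map_prod (iso_verts h) (iso_verts h) ` parcs G"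
    using eqs by (auto intro!: image_cong)
  moreover have "bij_betw (iso_verts h) (pverts G) (pverts H)"
    using digraph_isomorphism_inj_on_verts[OF h] eqs by (simp add: bij_betw_def)
  ultimately show "\<exists>f. bij_betw f (pverts G) (pverts H) \<and> parcs H = map_prod f f ` parcs G"
    by blast
next
  interpret pair_wf_digraph G by fact
  assume "\<exists>f. bij_betw f (pverts G) (pverts H) \<and> parcs H = map_prod f f ` parcs G"
  then obtain f where f: "inj_on f (pverts G)" "pverts H = f ` pverts G"
    and H: "parcs H = map_prod f f ` parcs G"
    by (auto simp: bij_betw_def)
  \<comment> \<open>The image must again have the form \<open>with_proj H\<close>, which forces
    \<open>fst\<close> and \<open>snd\<close> as tail and head.\<close>
  define h where "h = \<lparr>iso_verts = f, iso_arcs = map_prod f f, iso_head = snd, iso_tail = fst\<rparr>"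
  have "parcs G \<subseteq> pverts G \<times> pverts G"
    by (auto dest: in_arcsD1 in_arcsD2)
  then have "inj_on (map_prod f f) (parcs G)"
    using map_prod_inj_on[OF f(1) f(1)] inj_on_subset by blast
  then have "digraph_isomorphism h"
    using f wf_digraph_axioms unfolding digraph_isomorphism_def h_def by simp
  moreover have "with_proj H = app_iso h (with_proj G)"
    using f H by (simp add: with_proj_def app_iso_def h_def)
  ultimately show "graph_iso G H"
    unfolding digraph_iso_def by blast
qed

lemma graph_iso_edgeless_iff:
  assumes "pair_graph G"
  shows "graph_iso G (graph_complement (complete_graph n)) \<longleftrightarrow>
    card (pverts G) = n \<and> parcs G = {}"
proof -
  interpret pair_graph G by fact
  have "graph_iso G (graph_complement (complete_graph n)) \<longleftrightarrow>
      (\<exists>f. bij_betw f (pverts G) {..<n}) \<and> parcs G = {}"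
    unfolding graph_iso_iff[OF pair_wf_digraph_axioms] graph_complement_complete_graph by auto
  moreover have "(\<exists>f. bij_betw f (pverts G) {..<n}) \<longleftrightarrow> card (pverts G) = n"
    using bij_betw_iff_card[of "pverts G" "{..<n}"] by simp
  ultimately show ?thesis by simp
qed

text \<open>A bijection of the vertices carries the off-diagonal pairs onto the off-diagonal pairs,
  so only the order and completeness matter. Completeness is put as an arcless complement to mirror
  the edgeless case.\<close>

lemma graph_iso_complete_iff:
  assumes "pair_graph G"
  shows "graph_iso G (complete_graph n) \<longleftrightarrow>
    card (pverts G) = n \<and> parcs (graph_complement G) = {}"
proof -
  interpret pair_graph G by fact
  let ?P = "{(u, v). u \<in> pverts G \<and> v \<in> pverts G \<and> u \<noteq> v}"
  have sub: "parcs G \<subseteq> ?P"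
    using pair_no_loops by (fastforce dest: in_arcsD1 in_arcsD2)
  then have compl: "parcs (graph_complement G) = {} \<longleftrightarrow> parcs G = ?P"
    by (auto simp: graph_complement_def)
  have arcs_eq: "{(u, v). u < n \<and> v < n \<and> u \<noteq> v} = map_prod f f ` parcs G \<longleftrightarrow> parcs G = ?P"
    if f: "bij_betw f (pverts G) {..<n}" for f
  proof -
    have inj: "inj_on f (pverts G)" and img: "f ` pverts G = {..<n}"
      using f by (auto simp: bij_betw_def)
    have P: "{(u, v). u < n \<and> v < n \<and> u \<noteq> v} = map_prod f f ` ?P"
    proof
      show "map_prod f f ` ?P \<subseteq> {(u, v). u < n \<and> v < n \<and> u \<noteq> v}"
        using inj img by (auto dest: inj_onD)
      show "{(u, v). u < n \<and> v < n \<and> u \<noteq> v} \<subseteq> map_prod f f ` ?P"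
      proof clarify
        fix a b assume "a < n" "b < n" "a \<noteq> b"
        moreover from this obtain u v where "u \<in> pverts G" "v \<in> pverts G" "a = f u" "b = f v"
          using img by (metis imageE lessThan_iff)
        ultimately show "(a, b) \<in> map_prod f f ` ?P"
          by (auto intro!: image_eqI[where x = "(u, v)"])
      qed
    qed
    have "inj_on (map_prod f f) (pverts G \<times> pverts G)"
      by (rule map_prod_inj_on[OF inj inj])
    \<comment> \<open>Injectivity on all pairs of vertices cancels \<open>map_prod f f\<close> on
      both sides.\<close>
    then show ?thesis
      unfolding P using sub by (subst inj_on_image_eq_iff[where C = "pverts G \<times> pverts G"]) auto
  qed
  have "(\<exists>f. bij_betw f (pverts G) {..<n}) \<longleftrightarrow> card (pverts G) = n"
    using bij_betw_iff_card[of "pverts G" "{..<n}"] by simp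
  then show ?thesis
    unfolding graph_iso_iff[OF pair_wf_digraph_axioms] compl
    by (simp add: complete_graph_def arcs_eq cong: conj_cong)
qed

text \<open>Arcs of a \<open>pair_graph\<close> are loop-free and stay inside the vertex set, so the
  records are literally equal, not merely isomorphic.\<close>

lemma graph_complement_graph_complement:
  assumes "pair_graph G"
  shows "graph_complement (graph_complement G) = G"
proof -
  interpret pair_graph G by fact
  have "u \<in> pverts G \<and> v \<in> pverts G \<and> u \<noteq> v" if "(u, v) \<in> parcs G" for u v
    using pair_no_loops[OF that] that by (auto dest: in_arcsD1 in_arcsD2)
  then show ?thesis
    by (intro pair_pre_digraph.equality) (auto simp: graph_complement_def)
qed

text \<open>Complementation is an involution that preserves the vertices, so the two isomorphisms in
  each disjunct impose the same condition.\<close>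

lemma same_graph_pair_complete_iff:
  assumes "pair_graph G"
  shows "same_graph_pair G (graph_complement G)
      (complete_graph n) (graph_complement (complete_graph n)) \<longleftrightarrow>
    card (pverts G) = n \<and> (parcs G = {} \<or> parcs (graph_complement G) = {})"
proof -
  have "pverts (graph_complement G) = pverts G"
    by (simp add: graph_complement_def)
  then show ?thesis
    unfolding same_graph_pair_def
      graph_iso_edgeless_iff[OF assms] graph_iso_complete_iff[OF assms]
      graph_iso_edgeless_iff[OF pair_graph_graph_complement[OF assms]]
      graph_iso_complete_iff[OF pair_graph_graph_complement[OF assms]]
      graph_complement_graph_complement[OF assms]
    by auto
qed

section \<open>Bounds on the location-domination number\<close>

lemma location_domination_number_le:
  "locating_dominating G D \<Longrightarrow> location_domination_number G \<le> card D"
  unfolding location_domination_number_def by (rule Least_le) blast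

lemma location_domination_number_attained:
  obtains D where "locating_dominating G D" "card D = location_domination_number G"
  using LeastI[of "\<lambda>k. \<exists>D. locating_dominating G D \<and> card D = k" "card (pverts G)"]
    locating_dominating_pverts[of G]
  unfolding location_domination_number_def by blast

lemma location_domination_number_edgeless:
  assumes "parcs G = {}"
  shows "location_domination_number G = card (pverts G)"
proof -
  obtain D where D: "locating_dominating G D" "card D = location_domination_number G"
    by (rule location_domination_number_attained)
  then have "D = pverts G"
    using assms by (auto simp: locating_dominating_def neighborhood_def)
  with D show ?thesis by simp
qed

lemma location_domination_number_less:
  assumes "pair_graph G" and "parcs G \<noteq> {}"
  shows "location_domination_number G < card (pverts G)"
proof -
  interpret pair_graph G by fact
  obtain u v where uv: "(u, v) \<in> parcs G"
    using assms(2) by auto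
  have "u \<in> pverts G" "v \<in> pverts G" "u \<noteq> v"
    using uv pair_no_loops[OF uv] by (auto dest: in_arcsD1 in_arcsD2)
  \<comment> \<open>Only \<open>u\<close> lies outside: \<open>v\<close> dominates it, and there is
    no second vertex to separate it from.\<close>
  then have "locating_dominating G (pverts G - {u})"
    using uv by (auto simp: locating_dominating_def neighborhood_def)
  then have "location_domination_number G \<le> card (pverts G - {u})"
    by (rule location_domination_number_le)
  also have "\<dots> < card (pverts G)"
    using \<open>u \<in> pverts G\<close> by (intro card_Diff1_less) auto
  finally show ?thesis .
qed

text \<open>All vertices outside \<open>D\<close> have the same trace \<open>D\<close>, so there is
  at most one of them. This is the common core of the two lower bounds that follow.\<close>

lemma locating_dominating_card_le_of_full_trace:
  assumes "finite (pverts G)" and "locating_dominating G D"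
    and "\<And>u. u \<in> pverts G - D \<Longrightarrow> D \<subseteq> neighborhood G u"
  shows "card (pverts G) \<le> card D + 1"
proof -
  have "D \<subseteq> pverts G"
    using assms(2) by (simp add: locating_dominating_def)
  have "neighborhood G u \<inter> D = D" if "u \<in> pverts G - D" for u
    using assms(3)[OF that] by blast
  then have "\<forall>u \<in> pverts G - D. \<forall>v \<in> pverts G - D. u = v"
    using assms(2) unfolding locating_dominating_def by metis
  then have "card (pverts G - D) \<le> 1"
    using assms(1) by (simp add: card_le_Suc0_iff_eq)
  moreover have "card (pverts G - D) = card (pverts G) - card D"
    using assms(1) \<open>D \<subseteq> pverts G\<close> by (intro card_Diff_subset) (auto intro: finite_subset)
  ultimately show ?thesis
    by linarith
qed

lemma location_domination_number_complete:
  assumes "pair_graph G" and "parcs (graph_complement G) = {}"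
  shows "card (pverts G) \<le> location_domination_number G + 1"
proof -
  interpret pair_graph G by fact
  obtain D where D: "locating_dominating G D" "card D = location_domination_number G"
    by (rule location_domination_number_attained)
  then have "D \<subseteq> pverts G"
    by (simp add: locating_dominating_def)
  then have "D \<subseteq> neighborhood G u" if "u \<in> pverts G - D" for u
    using that assms(2) by (auto simp: neighborhood_def graph_complement_def)
  then show ?thesis
    using locating_dominating_card_le_of_full_trace[OF _ D(1)] D(2) by simp
qed

lemma location_domination_number_ge_2:
  assumes "finite (pverts G)" and "card (pverts G) \<ge> 3"
  shows "location_domination_number G \<ge> 2"
proof (rule ccontr)
  assume "\<not> 2 \<le> location_domination_number G"
  moreover obtain D where D: "locating_dominating G D" "card D = location_domination_number G"
    by (rule location_domination_number_attained)
  ultimately have "card D \<le> 1" by simp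
  have "finite D"
    using assms(1) D(1) by (auto simp: locating_dominating_def intro: finite_subset)
  then have single: "\<forall>a \<in> D. \<forall>b \<in> D. a = b"
    using \<open>card D \<le> 1\<close> by (simp add: card_le_Suc0_iff_eq)
  have "D \<subseteq> neighborhood G u" if "u \<in> pverts G - D" for u
  proof -
    have "neighborhood G u \<inter> D \<noteq> {}"
      using that D(1) by (auto simp: locating_dominating_def)
    then obtain d where "d \<in> neighborhood G u" "d \<in> D"
      by auto
    then show ?thesis
      \<comment> \<open>\<open>D\<close> has at most one element, so a neighborhood that meets
        \<open>D\<close> contains it.\<close>
      using single by (metis subsetI)
  qed
  then show False
    using locating_dominating_card_le_of_full_trace[OF assms(1) D(1)] \<open>card D \<le> 1\<close> assms(2)
    by simp
qed

section \<open>Order two and the extremal sum\<close>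

lemma edgeless_or_complete_of_card_2:
  assumes "pair_graph G" and "card (pverts G) = 2"
  shows "parcs G = {} \<or> parcs (graph_complement G) = {}"
proof -
  interpret pair_graph G by fact
  obtain a b where ab: "pverts G = {a, b}" "a \<noteq> b"
    using assms(2) by (auto simp: card_2_iff)
  have "(a, b) \<in> parcs G \<longleftrightarrow> (b, a) \<in> parcs G"
    using arcs_symmetric by blast
  moreover have "(u, v) \<in> {(a, b), (b, a)}" if "(u, v) \<in> parcs G" for u v
    using pair_no_loops[OF that] in_arcsD1[OF that] in_arcsD2[OF that] ab by auto
  then have "parcs G \<subseteq> {(a, b), (b, a)}"
    by (rule subrelI)
  ultimately show ?thesis
    using ab by (auto simp: graph_complement_def)
qed

text \<open>The edgeless graph contributes its order, and its complement, being complete, exactly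
  one less.\<close>

lemma location_domination_number_sum_edgeless:
  assumes "pair_graph G" and "parcs G = {}" and "card (pverts G) \<ge> 2"
  shows "location_domination_number G + location_domination_number (graph_complement G)
    = 2 * card (pverts G) - 1"
proof -
  let ?H = "graph_complement G"
  have H: "pair_graph ?H" "pverts ?H = pverts G" "parcs (graph_complement ?H) = {}"
    using pair_graph_graph_complement[OF assms(1)] assms(2)
    unfolding graph_complement_graph_complement[OF assms(1)]
    by (simp_all add: graph_complement_def)
  \<comment> \<open>The strict upper bound for \<open>?H\<close> needs an arc, which two distinct
    vertices supply.\<close>
  have "parcs ?H \<noteq> {}"
  proof -
    obtain a b where "a \<in> pverts G" "b \<in> pverts G" "a \<noteq> b"
      using card_2_iff obtain_subset_with_card_n[OF assms(3)] by (metis insert_subset)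
    then show ?thesis
      using assms(2) by (auto simp: graph_complement_def)
  qed
  then show ?thesis
    using location_domination_number_edgeless[OF assms(2)]
      location_domination_number_less[OF H(1)] location_domination_number_complete[OF H(1,3)] H(2)
    by simp
qed

theorem theorem5:
  fixes G :: "'a pair_pre_digraph" and n :: nat
  assumes "pair_graph G"
    and "card (pverts G) = n"
    and "n \<ge> 2"
  shows "3 \<le> location_domination_number G + location_domination_number (graph_complement G)
    \<and> location_domination_number G + location_domination_number (graph_complement G) \<le> 2 * n - 1
    \<and> (location_domination_number G + location_domination_number (graph_complement G) = 3
        \<longleftrightarrow> same_graph_pair G (graph_complement G)
              (complete_graph 2) (graph_complement (complete_graph 2)))
    \<and> (location_domination_number G + location_domination_number (graph_complement G) = 2 * n - 1
        \<longleftrightarrow> same_graph_pair G (graph_complement G)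
              (complete_graph n) (graph_complement (complete_graph n)))"
proof -
  let ?H = "graph_complement G"
  let ?s = "location_domination_number G + location_domination_number ?H"
  note H = pair_graph_graph_complement[OF assms(1)]
  have vH: "pverts ?H = pverts G"
    by (simp add: graph_complement_def)
  have fin: "finite (pverts G)"
    using assms(2,3) by (intro card_ge_0_finite) simp
  \<comment> \<open>If \<open>G\<close> is complete, the edgeless case is applied to
    \<open>?H\<close>, whose complement is \<open>G\<close>.\<close>
  have eq: "?s = 2 * n - 1" if "parcs G = {} \<or> parcs ?H = {}"
    using that location_domination_number_sum_edgeless[OF assms(1)]
      location_domination_number_sum_edgeless[OF H] assms(2,3) vH
    by (auto simp: graph_complement_graph_complement[OF assms(1)])
  \<comment> \<open>Both graphs have an arc, so each summand is at most
    \<open>n - 1\<close>.\<close>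
  have lt: "?s < 2 * n - 1" if "\<not> (parcs G = {} \<or> parcs ?H = {})"
    using that location_domination_number_less[OF assms(1)] location_domination_number_less[OF H]
      assms(2) vH
    by simp
  have small: "parcs G = {} \<or> parcs ?H = {}" if "n = 2"
    using edgeless_or_complete_of_card_2[OF assms(1)] assms(2) that by simp
  have large: "?s \<ge> 4" if "n \<noteq> 2"
  proof -
    have "n \<ge> 3" using that assms(3) by simp
    then show ?thesis
      using location_domination_number_ge_2[of G] location_domination_number_ge_2[of ?H]
        fin vH assms(2)
      by simp
  qed
  \<comment> \<open>For \<open>n = 2\<close> the extremal value \<open>2 * n - 1\<close> is 3; for
    larger \<open>n\<close> each summand is at least 2.\<close>
  have three: "?s = 3 \<longleftrightarrow> n = 2"
    using eq[OF small] large by (cases "n = 2") simp_all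
  have "3 \<le> ?s"
    using three large by linarith
  moreover have "?s \<le> 2 * n - 1"
    using eq lt by (metis less_imp_le order_refl)
  moreover have "?s = 2 * n - 1 \<longleftrightarrow> parcs G = {} \<or> parcs ?H = {}"
    using eq lt less_irrefl by metis
  \<comment> \<open>For the value 3, \<open>small\<close> supplies the edgeless-or-complete
    condition that the isomorphism criterion demands besides \<open>n = 2\<close>.\<close>
  ultimately show ?thesis
    unfolding same_graph_pair_complete_iff[OF assms(1)] using three small assms(2) by blast
qed

end
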